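(* Fix $\delta\in(0,1]$. For every sequence of data-driven ambiguity sets $(\hat{\mathcal A}_1,\dots,\hat{\mathcal A}_T)$ obtained from the ARL algorithm described in the context, and for each $k\in\{1,\dots,K\}$, $$\mathbb P\big(\hat{\mathcal A}_t=\bar{\mathcal A}_k\big)\ge 1-(k-1)\delta\qquad\forall t\in\{\bar t_{k-1}(\delta)+1,\dots,\bar t_k(\delta)\}.$$ Moreover, for every $t\in\{\tau(\delta)+1,\dots,T\}$, $\hat{\mathcal A}_t=\{\theta^0\}$ with probability at least $1-K\delta$. Here $K$, $\bar{\mathcal A}_k$, $\bar t_k(\delta)$ and $\tau(\delta)$ are the deterministic quantities defined in the context.
   Context: Setting. A firm sells a product over $T$ periods, choosing at the beginning of each period $t$ a price $p_t$ from a finite set $\mathcal P=\{p^1,\dots,p^n\}$, $n\ge1$. In period $t$, $N_t$ customers arrive and all face $p_t$; $N_t$ is unknown when $p_t$ is chosen (the arrival pattern $(N_1,\dots,N_T)$ is fixed). When price $p$ is offered, customer demands are i.i.d. draws from a fixed, time-invariant distribution $\mathrm D(p)$, independent across customers. $\Theta=\{\theta^0,\theta^1,\dots,\theta^m\}$, $m\ge0$, is a known finite candidate set containing the unknown true parameter $\theta^0$; $\mathrm D(\cdot)=\mathrm D(\cdot;\theta^0)+\zeta$ with $\zeta$ mean-zero noise. For $\theta\in\Theta$, $p\in\mathcal P$: $\mu(p;\theta)=\mathbb E[\mathrm D(p;\theta)]$ is the mean demand and $r(p;\theta)=p\,\mu(p;\theta)$ the expected revenue. Standing assumptions. (A1)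 There are $v,b\ge0$ such that for every $p\in\mathcal P$ and $\lambda\in(-1/b,1/b)$, $\mathbb E[\exp(\lambda(\mathrm D(p)-\mu(p;\theta^0)))]\le\exp(\lambda^2v^2/2)$. (A2) For all distinct $\theta,\theta'\in\Theta$ there is $p\in\mathcal P$ with $|\mu(p;\theta)-\mu(p;\theta')|>0$. Risk-adjusted revenue function. For each nonempty $\mathcal A\subseteq\Theta$, $\eta(\cdot;\mathcal A):\mathcal P\to[0,\infty)$ satisfies, for each $p\in\mathcal P$: (i) $\eta(p;\mathcal A)\ge\eta(p;\mathcal A')$ for every nonempty $\mathcal A'\subseteq\Theta$ with $\mathcal A\subseteq\mathcal A'$; (ii) $\eta(p;\mathcal A)=r(p;\theta^0)$ if $\mathcal A=\{\theta^0\}$. Notation. Partially informative prices: $\mathcal P^{\mathrm{PI}}(\mathcal A)=\mathcal P$ if $|\mathcal A|=1$, and $\mathcal P^{\mathrm{PI}}(\mathcal A)=\{p\in\mathcal P:\exists(\theta,\theta')\in\mathcal A^2,\ |\mu(p;\theta)-\mu(p;\theta')|>0\}$ if $|\mathcal A|\ge2$. $\mathcal I(p)=\{\theta\in\Theta:\mu(p;\theta)=\mu(p;\theta^0)\}$. For $p\in\mathcal P^{\mathrm{PI}}(\Theta)$: $c(p)=\min\{|\mu(p;\theta)-\mu(p;\theta')|>0:(\theta,\theta')\in\Theta^2\}$ and $n_\delta(p)=4\max\{2(v/c(p))^2,\ b/c(p)\}\ln(2/\delta)$. For a data set $\mathcal D(p)$ of demands collected at price $p$ (counted with multiplicity): $\ell(\theta;\mathcal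 D(p))=\big|\mu(p;\theta)-\frac1{|\mathcal D(p)|}\sum_{d\in\mathcal D(p)}d\big|$. ARL algorithm (inputs $\delta$, $\eta$). Initialize $\hat{\mathcal A}_1=\Theta$ and $\mathcal D(p)=\emptyset$ for each $p\in\mathcal P^{\mathrm{PI}}(\Theta)$. For $t=1,\dots,T$: play $\hat p_t=\arg\max\{\eta(p;\hat{\mathcal A}_t):p\in\mathcal P^{\mathrm{PI}}(\hat{\mathcal A}_t)\}$ and add the $N_t$ observed demands to $\mathcal D(\hat p_t)$; set $\hat{\mathcal A}_{t+1}=\hat{\mathcal A}_t$ if $|\mathcal D(\hat p_t)|<n_\delta(\hat p_t)$, else set $\hat{\mathcal A}_{t+1}=\{\theta\in\hat{\mathcal A}_t:\ell(\theta;\mathcal D(\hat p_t))<c(\hat p_t)/2\}$. Deterministic analogue and demand identification time. $\bar{\mathcal A}_1=\Theta$; for each integer $k\ge1$, $\bar p_k=\arg\max\{\eta(p;\bar{\mathcal A}_k):p\in\mathcal P^{\mathrm{PI}}(\bar{\mathcal A}_k)\}$ and $\bar{\mathcal A}_{k+1}=\bar{\mathcal A}_k\cap\mathcal I(\bar p_k)$. $K$ is the smallest index with $\bar{\mathcal A}_{K+1}=\{\theta^0\}$. $\bar t_0(\delta)=0$ and, for $k=1,\dots,K$, $$\bar t_k(\delta)=\min\Big\{\min\Big\{t\in\{\bar t_{k-1}(\delta)+1,\dots,T\}:\sum_{s=\bar t_{k-1}(\delta)+1}^{t}N_s\ge n_\delta(\bar p_k)\Big\},\ T+1\Big\},$$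 so that $\bar t_k(\delta)=T+1$ if no such $t$ exists. $\tau(\delta)=\bar t_K(\delta)$.
   Formalization: A singleton ambiguity set is kept without further tests: otherwise c(p), n_δ(p) may be undefined and the "moreover" claim can fail. Also assumed: v>0, or b>0, or all N_t≥1, so no empty data set is tested. The algorithm and its deterministic analogue share one tie-breaking rule. *)

theory Defs
  imports "HOL-Probability.Probability"
begin

text \<open>
  Prices are reals, parameters live in an arbitrary type. The argument \<open>mu\<close> below is always
  instantiated with \<open>mean_demand\<close>.
\<close>

definition mean_demand ::
  "'q measure \<Rightarrow> (real \<Rightarrow> 'a \<Rightarrow> 'q \<Rightarrow> real) \<Rightarrow> real \<Rightarrow> 'a \<Rightarrow> real" where
  "mean_demand Q Dem p \<theta> = (\<integral>q. Dem p \<theta> q \<partial>Q)"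

definition expected_revenue :: "(real \<Rightarrow> 'a \<Rightarrow> real) \<Rightarrow> real \<Rightarrow> 'a \<Rightarrow> real" where
  "expected_revenue mu p \<theta> = p * mu p \<theta>"

definition true_demand ::
  "'q measure \<Rightarrow> (real \<Rightarrow> 'a \<Rightarrow> 'q \<Rightarrow> real) \<Rightarrow> (real \<Rightarrow> 'q \<Rightarrow> real) \<Rightarrow> 'a \<Rightarrow> real \<Rightarrow> real measure" where
  "true_demand Q Dem \<zeta> \<theta>0 p = distr Q borel (\<lambda>q. Dem p \<theta>0 q + \<zeta> p q)"

definition informative_prices ::
  "real set \<Rightarrow> (real \<Rightarrow> 'a \<Rightarrow> real) \<Rightarrow> 'a set \<Rightarrow> real set" where
  "informative_prices P mu A =
     (if card A = 1 then P
      else {p \<in> P. \<exists>\<theta>\<in>A. \<exists>\<theta>'\<in>A. \<bar>mu p \<theta> - mu p \<theta>'\<bar> > 0})"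

definition indistinguishable ::
  "'a set \<Rightarrow> (real \<Rightarrow> 'a \<Rightarrow> real) \<Rightarrow> 'a \<Rightarrow> real \<Rightarrow> 'a set" where
  "indistinguishable \<Theta> mu \<theta>0 p = {\<theta> \<in> \<Theta>. mu p \<theta> = mu p \<theta>0}"

text \<open>
  The set in \<open>gap\<close> is empty, and \<open>Min\<close> unspecified, at prices that separate no two parameters
  of \<open>\<Theta>\<close>. The algorithm below consults \<open>gap\<close> only if its current set is not a singleton,
  which forces its price to be an informative one for \<open>\<Theta>\<close> unless that set is empty.
\<close>

definition gap :: "'a set \<Rightarrow> (real \<Rightarrow> 'a \<Rightarrow> real) \<Rightarrow> real \<Rightarrow> real" where
  "gap \<Theta> mu p = Min {d. d > 0 \<and> (\<exists>\<theta>\<in>\<Theta>. \<exists>\<theta>'\<in>\<Theta>. d = \<bar>mu p \<theta> - mu p \<theta>'\<bar>)}"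

definition sample_threshold ::
  "real \<Rightarrow> real \<Rightarrow> (real \<Rightarrow> real) \<Rightarrow> real \<Rightarrow> real \<Rightarrow> real" where
  "sample_threshold v b c \<delta> p = 4 * max (2 * (v / c p)\<^sup>2) (b / c p) * ln (2 / \<delta>)"

definition loss :: "(real \<Rightarrow> 'a \<Rightarrow> real) \<Rightarrow> real \<Rightarrow> 'a \<Rightarrow> real multiset \<Rightarrow> real" where
  "loss mu p \<theta> D = \<bar>mu p \<theta> - sum_mset D / real (size D)\<bar>"

text \<open>
  A fixed tie-breaking rule for the argmax, as a function of the ambiguity set. The algorithm and
  its deterministic analogue use the same rule.
\<close>

definition argmax_rule ::
  "real set \<Rightarrow> 'a set \<Rightarrow> (real \<Rightarrow> 'a \<Rightarrow> real) \<Rightarrow> (real \<Rightarrow> 'a set \<Rightarrow> real) \<Rightarrow> ('a set \<Rightarrow> real) \<Rightarrow> bool" where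
  "argmax_rule P \<Theta> mu \<eta> sel \<longleftrightarrow>
     (\<forall>A. A \<subseteq> \<Theta> \<and> A \<noteq> {} \<longrightarrow>
        is_arg_max (\<lambda>p. \<eta> p A) (\<lambda>p. p \<in> informative_prices P mu A) (sel A))"

text \<open>
  \<open>Y t i p\<close> is the demand of customer \<open>i\<close> of period \<open>t\<close> if offered price \<open>p\<close>. Customers are
  independent of each other; the dependence between the demands of one customer at different
  prices, of which only one is ever observed, is arbitrary.
\<close>

definition demand_model ::
  "'w measure \<Rightarrow> real set \<Rightarrow> (real \<Rightarrow> real measure) \<Rightarrow> nat \<Rightarrow> (nat \<Rightarrow> nat) \<Rightarrow>
   (nat \<Rightarrow> nat \<Rightarrow> real \<Rightarrow> 'w \<Rightarrow> real) \<Rightarrow> bool" where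
  "demand_model M P D T N Y \<longleftrightarrow>
     (\<forall>t\<in>{1..T}. \<forall>i<N t. \<forall>p\<in>P.
        Y t i p \<in> borel_measurable M \<and> distr M borel (Y t i p) = D p) \<and>
     prob_space.indep_vars M (\<lambda>_. PiM P (\<lambda>_. borel))
       (\<lambda>(t, i) \<omega>. \<lambda>p\<in>P. Y t i p \<omega>) (SIGMA t:{1..T}. {..<N t})"

text \<open>
  \<open>arl_state \<dots> t\<close> is the ambiguity set together with the data sets after period \<open>t\<close>, so the
  ambiguity set that is in force in period \<open>t\<close> is the one after period \<open>t - 1\<close>. A singleton is
  kept: every price may then be played, also prices for which no test is defined, and a test could
  only return the same set or the empty set, and no price is defined for the latter.
\<close>

primrec arl_state ::
  "'a set \<Rightarrow> (real \<Rightarrow> 'a \<Rightarrow> real) \<Rightarrow> (real \<Rightarrow> real) \<Rightarrow> (real \<Rightarrow> real) \<Rightarrow> ('a set \<Rightarrow> real) \<Rightarrow>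
   (nat \<Rightarrow> nat) \<Rightarrow> (nat \<Rightarrow> nat \<Rightarrow> real \<Rightarrow> 'w \<Rightarrow> real) \<Rightarrow> 'w \<Rightarrow> nat \<Rightarrow>
   'a set \<times> (real \<Rightarrow> real multiset)" where
  "arl_state \<Theta> mu c n sel N Y \<omega> 0 = (\<Theta>, \<lambda>_. {#})"
| "arl_state \<Theta> mu c n sel N Y \<omega> (Suc t) =
     (let (A, D) = arl_state \<Theta> mu c n sel N Y \<omega> t;
          p = sel A;
          D' = D(p := D p + {# Y (Suc t) i p \<omega>. i \<in># mset_set {..<N (Suc t)} #})
      in (if card A = 1 \<or> real (size (D' p)) < n p then A
          else {\<theta> \<in> A. loss mu p \<theta> (D' p) < c p / 2},
          D'))"

definition arl_set ::
  "'a set \<Rightarrow> (real \<Rightarrow> 'a \<Rightarrow> real) \<Rightarrow> (real \<Rightarrow> real) \<Rightarrow> (real \<Rightarrow> real) \<Rightarrow> ('a set \<Rightarrow> real) \<Rightarrow>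
   (nat \<Rightarrow> nat) \<Rightarrow> (nat \<Rightarrow> nat \<Rightarrow> real \<Rightarrow> 'w \<Rightarrow> real) \<Rightarrow> nat \<Rightarrow> 'w \<Rightarrow> 'a set" where
  "arl_set \<Theta> mu c n sel N Y t \<omega> = fst (arl_state \<Theta> mu c n sel N Y \<omega> (t - 1))"

text \<open>The sequence is indexed from 1; its value at 0 is a dummy.\<close>

primrec det_set ::
  "'a set \<Rightarrow> (real \<Rightarrow> 'a \<Rightarrow> real) \<Rightarrow> 'a \<Rightarrow> ('a set \<Rightarrow> real) \<Rightarrow> nat \<Rightarrow> 'a set" where
  "det_set \<Theta> mu \<theta>0 sel 0 = \<Theta>"
| "det_set \<Theta> mu \<theta>0 sel (Suc k) =
     (if k = 0 then \<Theta>
      else det_set \<Theta> mu \<theta>0 sel k \<inter> indistinguishable \<Theta> mu \<theta>0 (sel (det_set \<Theta> mu \<theta>0 sel k)))"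

primrec phase_end ::
  "nat \<Rightarrow> (nat \<Rightarrow> nat) \<Rightarrow> (real \<Rightarrow> real) \<Rightarrow> (nat \<Rightarrow> real) \<Rightarrow> nat \<Rightarrow> nat" where
  "phase_end T N n pbar 0 = 0"
| "phase_end T N n pbar (Suc k) =
     Min (insert (T + 1)
       {t \<in> {phase_end T N n pbar k + 1..T}.
          real (\<Sum>s = phase_end T N n pbar k + 1..t. N s) \<ge> n (pbar (Suc k))})"

end

(*
  Say that phase k is good if its sample mean at the price of the phase is within c/2 of the true
  mean. A parameter that is indistinguishable from the true one at that price then passes the test
  ending the phase, and any other parameter fails it, so on the event that all earlier phases are
  good the algorithm follows the deterministic sequence, and the phases end at the deterministic
  times. Hence the sample of phase k can be taken to be the demands at the deterministic price in
  a deterministic set of periods: no conditioning on the adaptively chosen prices is needed.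
  A Chernoff bound shows that a phase is bad with probability at most delta, and the union bound
  finishes the proof.
*)
theory Submission
  imports Defs
begin

section \<open>Deviation of sample means\<close>

text \<open>Markov's inequality for \<open>exp (l * sum)\<close>, whose expectation factors by
  independence into terms bounded by \<open>B\<close>.\<close>

lemma (in prob_space) Chernoff_indep_sum:
  fixes X :: "'i \<Rightarrow> 'a \<Rightarrow> real"
  assumes I: "finite I" and ind: "indep_vars (\<lambda>_. borel) X I" and l: "l > 0"
    and mgf: "\<And>i. i \<in> I \<Longrightarrow> integrable M (\<lambda>x. exp (l * X i x))"
      "\<And>i. i \<in> I \<Longrightarrow> expectation (\<lambda>x. exp (l * X i x)) \<le> B"
  shows "prob {x \<in> space M. a \<le> (\<Sum>i\<in>I. X i x)} \<le> exp (- l * a) * B ^ card I"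
proof -
  have ind': "indep_vars (\<lambda>_. borel) (\<lambda>i x. exp (l * X i x)) I"
    by (rule indep_vars_compose2[OF ind]) measurable
  have eq: "exp (l * (\<Sum>i\<in>I. X i x)) = (\<Prod>i\<in>I. exp (l * X i x))" for x
    by (simp add: sum_distrib_left exp_sum I)
  have int: "integrable M (\<lambda>x. exp (l * (\<Sum>i\<in>I. X i x)))"
    unfolding eq by (rule indep_vars_integrable[OF I ind' mgf(1)])
  have "prob {x \<in> space M. a \<le> (\<Sum>i\<in>I. X i x)}
      \<le> exp (- l * a) * (\<integral>x\<in>space M. exp (l * (\<Sum>i\<in>I. X i x)) \<partial>M)"
    by (rule Chernoff_ineq_ge[OF l, unfolded set_integrable_def])
      (auto intro: integrable_mult_indicator int simp del: real_scaleR_def)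
  also have "(\<integral>x\<in>space M. exp (l * (\<Sum>i\<in>I. X i x)) \<partial>M)
      = (\<Prod>i\<in>I. expectation (\<lambda>x. exp (l * X i x)))"
    unfolding set_integral_space[OF int] unfolding eq
    by (rule indep_vars_lebesgue_integral[OF I ind' mgf(1)])
  also have "\<dots> \<le> (\<Prod>i\<in>I. B)"
    by (intro prod_mono conjI mgf(2) integral_nonneg_AE) auto
  finally show ?thesis by (simp add: mult_left_mono)
qed

text \<open>Optimises the Chernoff exponent over the admissible \<open>l\<close>. The unconstrained
  minimiser \<open>x / v\<^sup>2\<close> is admissible iff \<open>b * x < v\<^sup>2\<close> and
  gives exponent \<open>- m * x\<^sup>2 / (2 * v\<^sup>2)\<close>; otherwise \<open>l\<close> near
  \<open>1 / b\<close> gives nearly \<open>- m * x / (2 * b)\<close> or less. The two lower bounds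
  on \<open>m\<close> bring these down to \<open>- L\<close>.\<close>

lemma subexponential_rate:
  fixes v b x m q L :: real
  assumes "v \<ge> 0" "b \<ge> 0" "x > 0" "m > 0" "L \<ge> 0"
    and m: "m \<ge> 2 * v\<^sup>2 / x\<^sup>2 * L" "m \<ge> 2 * b / x * L"
    and q: "\<And>l. l > 0 \<Longrightarrow> b * l < 1 \<Longrightarrow> q \<le> exp (m * (l\<^sup>2 * v\<^sup>2 / 2 - l * x))"
  shows "q \<le> exp (- L)"
proof -
  consider "v > 0" "b * x < v\<^sup>2" | "b > 0" "v\<^sup>2 \<le> b * x" | "v = 0" "b = 0"
  proof (cases "v = 0")
    case True
    then show thesis using that(2,3) assms by (cases "b = 0") auto
  next
    case False
    then have "v > 0" "v\<^sup>2 > 0" using assms by auto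
    then show thesis using that(1,2) assms by (cases "b * x < v\<^sup>2"; cases "b = 0") auto
  qed
  then show ?thesis
  proof cases
    case 1
    have "q \<le> exp (m * ((x / v\<^sup>2)\<^sup>2 * v\<^sup>2 / 2 - (x / v\<^sup>2) * x))"
      using 1 assms by (intro q) (auto simp: field_simps)
    also have "m * ((x / v\<^sup>2)\<^sup>2 * v\<^sup>2 / 2 - (x / v\<^sup>2) * x) = - (m * x\<^sup>2 / (2 * v\<^sup>2))"
      using 1 by (simp add: field_simps power2_eq_square)
    also have "exp \<dots> \<le> exp (- L)"
      using m(1) 1 assms by (simp add: field_simps)
    finally show ?thesis .
  next
    case 2
    \<comment> \<open>The right choice would be \<open>l = 1 / b\<close>, which is excluded, so it is approached from below.\<close>
    have *: "q \<le> exp (- (z * L))" if z: "0 < z" "z < 1" for z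
    proof -
      define l where "l = z / b"
      have l: "l > 0" "b * l < 1" "z = b * l" using z 2 by (auto simp: l_def)
      \<comment> \<open>With \<open>v\<^sup>2 \<le> b * x\<close> and \<open>b * l < 1\<close> the
        quadratic term cancels at most half of \<open>l * x\<close>.\<close>
      have "l\<^sup>2 * v\<^sup>2 \<le> l\<^sup>2 * (b * x)" using 2 by (intro mult_left_mono) auto
      also have "\<dots> = (b * l) * (l * x)" by (simp add: power2_eq_square)
      also have "\<dots> \<le> 1 * (l * x)" using l assms by (intro mult_right_mono) auto
      finally have "m * (l\<^sup>2 * v\<^sup>2 / 2 - l * x) \<le> m * (- (l * x) / 2)"
        using assms by (intro mult_left_mono) auto
      also have "\<dots> \<le> - (z * L)"
      proof -
        have "2 * b * L \<le> m * x" using m(2) assms by (simp add: field_simps)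
        then have "l * (2 * b * L) \<le> l * (m * x)" using l by (intro mult_left_mono) auto
        then show ?thesis using l by (simp add: algebra_simps)
      qed
      finally show ?thesis using q[OF l(1,2)] by (meson exp_le_cancel_iff order_trans)
    qed
    \<comment> \<open>The limit \<open>z\<close> to 1 is taken on logarithms, where the bound is
      linear in \<open>z\<close>; this needs \<open>q > 0\<close>.\<close>
    show ?thesis
    proof (cases "q > 0")
      case True
      have "L \<le> - ln q"
        by (rule field_le_mult_one_interval)
          (use * True in \<open>simp add: ln_ge_iff le_minus_iff flip: ln_le_cancel_iff\<close>)
      then show ?thesis using True by (metis exp_le_cancel_iff exp_ln le_minus_iff)
    qed (use exp_gt_zero[of "- L"] in linarith)
  next
    case 3
    \<comment> \<open>Here the exponent is \<open>- m * l * x\<close> and every positive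
      \<open>l\<close> is allowed, so \<open>l = L / (m * x)\<close> gives exactly
      \<open>- L\<close>. It is positive only if \<open>L\<close> is, hence the split.\<close>
    show ?thesis
    proof (cases "L = 0")
      case True
      have "q \<le> exp (m * (1\<^sup>2 * v\<^sup>2 / 2 - 1 * x))" using 3 by (intro q) auto
      also have "\<dots> \<le> exp 0" using 3 assms by simp
      finally show ?thesis using True by simp
    next
      case False
      have "q \<le> exp (m * ((L / (m * x))\<^sup>2 * v\<^sup>2 / 2 - L / (m * x) * x))"
        using 3 False assms by (intro q) auto
      then show ?thesis using 3 assms by simp
    qed
  qed
qed

text \<open>Each tail gets \<open>\<delta> / 2\<close>, that is
  \<open>L = ln (2 / \<delta>)\<close>, at deviation \<open>x = c / 2\<close>. With these values the
  two requirements of \<open>subexponential_rate\<close> on the sample size become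
  \<open>8 * (v / c)\<^sup>2 * L\<close> and \<open>4 * (b / c) * L\<close>, whose maximum is the
  threshold.\<close>

lemma (in prob_space) sample_mean_deviation:
  fixes X :: "'i \<Rightarrow> 'a \<Rightarrow> real"
  assumes I: "finite I" "I \<noteq> {}" and ind: "indep_vars (\<lambda>_. borel) X I"
    and vb: "v \<ge> 0" "b \<ge> 0" and c: "c > 0" and \<delta>: "0 < \<delta>" "\<delta> \<le> 1"
    and mgf: "\<And>i l. i \<in> I \<Longrightarrow> b * \<bar>l\<bar> < 1 \<Longrightarrow> integrable M (\<lambda>x. exp (l * (X i x - \<mu>)))"
      "\<And>i l. i \<in> I \<Longrightarrow> b * \<bar>l\<bar> < 1 \<Longrightarrow>
         expectation (\<lambda>x. exp (l * (X i x - \<mu>))) \<le> exp (l\<^sup>2 * v\<^sup>2 / 2)"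
    and card: "real (card I) \<ge> 4 * max (2 * (v / c)\<^sup>2) (b / c) * ln (2 / \<delta>)"
  shows "prob {x \<in> space M. c / 2 \<le> \<bar>\<mu> - (\<Sum>i\<in>I. X i x) / card I\<bar>} \<le> \<delta>"
proof -
  define m where "m = real (card I)"
  have m: "m > 0" using I by (simp add: m_def card_gt_0_iff)
  have L: "ln (2 / \<delta>) \<ge> 0" using \<delta> by simp
  have m1: "m \<ge> 2 * v\<^sup>2 / (c / 2)\<^sup>2 * ln (2 / \<delta>)"
  proof -
    have "4 * (2 * (v / c)\<^sup>2) * ln (2 / \<delta>) \<le> m"
      using card L unfolding m_def
      by (intro order_trans[OF _ card] mult_right_mono mult_left_mono) auto
    then show ?thesis by (simp add: power_divide)
  qed
  have m2: "m \<ge> 2 * b / (c / 2) * ln (2 / \<delta>)"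
  proof -
    have "4 * (b / c) * ln (2 / \<delta>) \<le> m"
      using card L unfolding m_def
      by (intro order_trans[OF _ card] mult_right_mono mult_left_mono) auto
    then show ?thesis by simp
  qed
  have exp_L: "exp (- ln (2 / \<delta>)) = \<delta> / 2" using \<delta> by (simp add: exp_minus)
  \<comment> \<open>The sign \<open>s\<close> treats the upper and the lower tail together.\<close>
  have tail: "prob {x \<in> space M. m * (c / 2) \<le> (\<Sum>i\<in>I. s * (X i x - \<mu>))} \<le> \<delta> / 2"
    if s: "s \<in> {1, -1}" for s :: real
    unfolding exp_L[symmetric]
  proof (rule subexponential_rate[OF vb _ m L m1 m2])
    fix l :: real assume l: "l > 0" "b * l < 1"
    have ls: "b * \<bar>l * s\<bar> < 1" "(l * s)\<^sup>2 = l\<^sup>2" using l s by (auto simp: power_mult_distrib)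
    have ind': "indep_vars (\<lambda>_. borel) (\<lambda>i x. s * (X i x - \<mu>)) I"
      by (rule indep_vars_compose2[OF ind]) measurable
    have "prob {x \<in> space M. m * (c / 2) \<le> (\<Sum>i\<in>I. s * (X i x - \<mu>))}
        \<le> exp (- l * (m * (c / 2))) * exp (l\<^sup>2 * v\<^sup>2 / 2) ^ card I"
      using mgf[OF _ ls(1)] ls(2)
      by (intro Chernoff_indep_sum[OF I(1) ind' l(1)]) (auto simp: mult.assoc)
    also have "\<dots> = exp (m * (l\<^sup>2 * v\<^sup>2 / 2 - l * (c / 2)))"
      by (simp add: m_def algebra_simps flip: exp_of_nat_mult exp_add)
    finally show "prob {x \<in> space M. m * (c / 2) \<le> (\<Sum>i\<in>I. s * (X i x - \<mu>))}
      \<le> exp (m * (l\<^sup>2 * v\<^sup>2 / 2 - l * (c / 2)))" .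
  qed (use c in simp)
  have X [measurable]: "X i \<in> borel_measurable M" if "i \<in> I" for i
    using ind that by (auto simp: indep_vars_def)
  let ?U = "\<lambda>s. {x \<in> space M. m * (c / 2) \<le> (\<Sum>i\<in>I. s * (X i x - \<mu>))}"
  have meas: "?U s \<in> sets M" for s by measurable
  have "{x \<in> space M. c / 2 \<le> \<bar>\<mu> - (\<Sum>i\<in>I. X i x) / card I\<bar>} \<subseteq> ?U 1 \<union> ?U (-1)"
  proof safe
    fix x assume "x \<in> space M" and dev: "c / 2 \<le> \<bar>\<mu> - (\<Sum>i\<in>I. X i x) / card I\<bar>"
      and n: "\<not> m * (c / 2) \<le> (\<Sum>i\<in>I. - 1 * (X i x - \<mu>))"
    have "m * (c / 2) \<le> m * \<bar>\<mu> - (\<Sum>i\<in>I. X i x) / m\<bar>"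
      using dev m by (intro mult_left_mono) (auto simp: m_def)
    also have "\<dots> = \<bar>m * \<mu> - (\<Sum>i\<in>I. X i x)\<bar>"
      using m by (simp add: abs_mult_pos' right_diff_distrib)
    finally show "m * (c / 2) \<le> (\<Sum>i\<in>I. 1 * (X i x - \<mu>))"
      using n by (auto simp: sum_subtractf sum_negf m_def abs_if split: if_splits)
  qed
  then have "prob {x \<in> space M. c / 2 \<le> \<bar>\<mu> - (\<Sum>i\<in>I. X i x) / card I\<bar>} \<le> prob (?U 1 \<union> ?U (-1))"
    using meas by (intro finite_measure_mono) auto
  also have "\<dots> \<le> prob (?U 1) + prob (?U (-1))"
    by (rule measure_Un_le[OF meas meas])
  also have "\<dots> \<le> \<delta>" using tail[of 1] tail[of "-1"] by simp
  finally show ?thesis .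
qed

text \<open>The complement of \<open>E\<close> is covered by the \<open>i\<close> bad
  events.\<close>

lemma (in prob_space) union_bound_good_events:
  fixes G :: "'a \<Rightarrow> nat \<Rightarrow> bool"
  assumes G: "\<And>j. j < i \<Longrightarrow> {\<omega> \<in> space M. \<not> G \<omega> j} \<in> sets M"
    and bad: "\<And>j. j < i \<Longrightarrow> prob {\<omega> \<in> space M. \<not> G \<omega> j} \<le> \<delta>"
    and E: "E \<in> sets M" and good: "\<And>\<omega>. \<omega> \<in> space M \<Longrightarrow> (\<And>j. j < i \<Longrightarrow> G \<omega> j) \<Longrightarrow> \<omega> \<in> E"
  shows "prob E \<ge> 1 - real i * \<delta>"
proof -
  have "prob (space M - E) \<le> prob (\<Union>j<i. {\<omega> \<in> space M. \<not> G \<omega> j})"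
    using G good by (intro finite_measure_mono sets.finite_UN) auto
  also have "\<dots> \<le> (\<Sum>j<i. prob {\<omega> \<in> space M. \<not> G \<omega> j})"
    using G by (intro measure_UNION_le) auto
  also have "\<dots> \<le> (\<Sum>j<i. \<delta>)"
    by (intro sum_mono bad) auto
  finally show ?thesis using prob_compl[OF E] by simp
qed

section \<open>Data sets, phases and gaps\<close>

text \<open>The demands at \<open>p\<close> in the periods of \<open>S\<close>, whether or not
  \<open>p\<close> was played then. This expresses data sets of the algorithm through demands with
  fixed indices.\<close>

definition sampled ::
  "(nat \<Rightarrow> nat) \<Rightarrow> (nat \<Rightarrow> nat \<Rightarrow> real \<Rightarrow> 'w \<Rightarrow> real) \<Rightarrow> real \<Rightarrow> nat set \<Rightarrow> 'w \<Rightarrow> real multiset" where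
  "sampled N Y p S \<omega> = (\<Sum>s\<in>S. {# Y s i p \<omega>. i \<in># mset_set {..<N s} #})"

lemma sampled_empty [simp]: "sampled N Y p {} \<omega> = {#}"
  by (simp add: sampled_def)

lemma sampled_insert:
  "finite S \<Longrightarrow> t \<notin> S \<Longrightarrow>
     sampled N Y p (insert t S) \<omega> = sampled N Y p S \<omega> + {# Y t i p \<omega>. i \<in># mset_set {..<N t} #}"
  by (simp add: sampled_def add.commute)

lemma sampled_Suc:
  "a \<le> t \<Longrightarrow> sampled N Y p {Suc a..Suc t} \<omega>
     = sampled N Y p {Suc a..t} \<omega> + {# Y (Suc t) i p \<omega>. i \<in># mset_set {..<N (Suc t)} #}"
  by (subst sampled_insert[symmetric]) (auto simp: atLeastAtMostSuc_conv)

lemma size_sampled: "finite S \<Longrightarrow> size (sampled N Y p S \<omega>) = (\<Sum>s\<in>S. N s)"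
  by (induction rule: finite_induct) (simp_all add: sampled_insert)

lemma sum_mset_sampled:
  "finite S \<Longrightarrow> sum_mset (sampled N Y p S \<omega>) = (\<Sum>s\<in>S. \<Sum>i<N s. Y s i p \<omega>)"
  by (induction rule: finite_induct) (simp_all add: sampled_insert sum_unfold_sum_mset add.commute)

text \<open>Unfolds the minimum: \<open>T + 1\<close> is the default for a phase that does not end
  within the horizon, so a value up to \<open>T\<close> certifies that the threshold was
  reached.\<close>

lemma phase_end_Suc_properties:
  fixes T N n pbar k
  defines "tb \<equiv> phase_end T N n pbar"
  shows phase_end_Suc_le: "tb (Suc k) \<le> T + 1"
    and phase_end_mono_Suc: "tb k \<le> T + 1 \<Longrightarrow> tb k \<le> tb (Suc k)"
    and phase_end_reached: "tb (Suc k) \<le> T \<Longrightarrow>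
      tb k < tb (Suc k) \<and> n (pbar (Suc k)) \<le> real (\<Sum>s = Suc (tb k)..tb (Suc k). N s)"
    and phase_end_not_reached: "tb k < t \<Longrightarrow> t < tb (Suc k) \<Longrightarrow>
      real (\<Sum>s = Suc (tb k)..t. N s) < n (pbar (Suc k))"
proof -
  let ?S = "insert (T + 1) {t \<in> {tb k + 1..T}. real (\<Sum>s = tb k + 1..t. N s) \<ge> n (pbar (Suc k))}"
  have tb: "tb (Suc k) = Min ?S" by (simp add: tb_def)
  have "tb (Suc k) \<in> ?S" unfolding tb by (rule Min_in) auto
  then show "tb (Suc k) \<le> T + 1" "tb k \<le> T + 1 \<Longrightarrow> tb k \<le> tb (Suc k)"
    "tb (Suc k) \<le> T \<Longrightarrow>
      tb k < tb (Suc k) \<and> n (pbar (Suc k)) \<le> real (\<Sum>s = Suc (tb k)..tb (Suc k). N s)"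
    by auto
  have least: "tb (Suc k) \<le> t" if "t \<in> ?S" for t
    unfolding tb by (rule Min_le) (use that in auto)
  assume t: "tb k < t" "t < tb (Suc k)"
  have "tb (Suc k) \<le> T + 1" by (rule least) simp
  then show "real (\<Sum>s = Suc (tb k)..t. N s) < n (pbar (Suc k))"
    using least[of t] t by (force simp: not_less)
qed

lemma phase_end_le: "phase_end T N n pbar k \<le> T + 1"
  by (cases k) (simp_all only: phase_end_Suc_le phase_end.simps(1) le0)

lemma phase_end_mono: "j \<le> k \<Longrightarrow> phase_end T N n pbar j \<le> phase_end T N n pbar k"
  by (rule lift_Suc_mono_le[where f = "phase_end T N n pbar"], rule phase_end_mono_Suc[OF phase_end_le])

lemma finite_gaps:
  assumes "finite \<Theta>"
  shows "finite {d. d > 0 \<and> (\<exists>\<theta>\<in>\<Theta>. \<exists>\<theta>'\<in>\<Theta>. d = \<bar>mu p \<theta> - mu p \<theta>'\<bar>)}"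
proof (rule finite_subset)
  show "{d. d > 0 \<and> (\<exists>\<theta>\<in>\<Theta>. \<exists>\<theta>'\<in>\<Theta>. d = \<bar>mu p \<theta> - mu p \<theta>'\<bar>)}
      \<subseteq> (\<lambda>(\<theta>, \<theta>'). \<bar>mu p \<theta> - mu p \<theta>'\<bar>) ` (\<Theta> \<times> \<Theta>)"
    by auto
qed (use assms in simp)

lemma gap_le:
  assumes "finite \<Theta>" "\<theta> \<in> \<Theta>" "\<theta>' \<in> \<Theta>" "mu p \<theta> \<noteq> mu p \<theta>'"
  shows "gap \<Theta> mu p \<le> \<bar>mu p \<theta> - mu p \<theta>'\<bar>"
  unfolding gap_def by (rule Min_le[OF finite_gaps]) (use assms in auto)

lemma gap_pos:
  assumes "finite \<Theta>" "\<theta> \<in> \<Theta>" "\<theta>' \<in> \<Theta>" "mu p \<theta> \<noteq> mu p \<theta>'"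
  shows "gap \<Theta> mu p > 0"
proof -
  have "gap \<Theta> mu p \<in> {d. d > 0 \<and> (\<exists>\<theta>\<in>\<Theta>. \<exists>\<theta>'\<in>\<Theta>. d = \<bar>mu p \<theta> - mu p \<theta>'\<bar>)}"
    unfolding gap_def
  proof (rule Min_in[OF finite_gaps[OF assms(1)]])
    have "\<bar>mu p \<theta> - mu p \<theta>'\<bar> \<in> {d. d > 0 \<and> (\<exists>\<theta>\<in>\<Theta>. \<exists>\<theta>'\<in>\<Theta>. d = \<bar>mu p \<theta> - mu p \<theta>'\<bar>)}"
      using assms by auto
    then show "{d. d > 0 \<and> (\<exists>\<theta>\<in>\<Theta>. \<exists>\<theta>'\<in>\<Theta>. d = \<bar>mu p \<theta> - mu p \<theta>'\<bar>)} \<noteq> {}" by blast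
  qed
  then show ?thesis by simp
qed

section \<open>The deterministic sequence of ambiguity sets\<close>

locale price_selection =
  fixes P :: "real set" and \<Theta> :: "'a set" and mu :: "real \<Rightarrow> 'a \<Rightarrow> real" and \<theta>0 :: 'a
    and sel :: "'a set \<Rightarrow> real"
  assumes finite_params: "finite \<Theta>" and true_param: "\<theta>0 \<in> \<Theta>"
    and sel: "A \<subseteq> \<Theta> \<Longrightarrow> A \<noteq> {} \<Longrightarrow> sel A \<in> informative_prices P mu A"
begin

abbreviation "Abar \<equiv> det_set \<Theta> mu \<theta>0 sel"
abbreviation "pbar k \<equiv> sel (Abar k)"
abbreviation "K \<equiv> LEAST K. Abar (K + 1) = {\<theta>0}"

lemma sel_in_prices: "A \<subseteq> \<Theta> \<Longrightarrow> A \<noteq> {} \<Longrightarrow> sel A \<in> P"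
  using sel[of A] by (auto simp: informative_prices_def split: if_splits)

lemma det_set_subset: "Abar k \<subseteq> \<Theta>"
  by (induction k) auto

lemma true_param_in_det_set: "\<theta>0 \<in> Abar k"
  by (induction k) (auto simp: true_param indistinguishable_def)

lemma det_set_antimono: "j \<le> k \<Longrightarrow> Abar k \<subseteq> Abar j"
  by (rule lift_Suc_antimono_le) auto

lemma card_det_set_ne_1: "Abar k \<noteq> {\<theta>0} \<Longrightarrow> card (Abar k) \<noteq> 1"
  using true_param_in_det_set[of k] by (auto simp: card_1_singleton_iff)

text \<open>An informative price separates two members of the set, and at least one of them must
  then differ in mean from \<open>\<theta>0\<close>.\<close>

lemma separating_param:
  assumes "Abar k \<noteq> {\<theta>0}"
  obtains \<theta> where "\<theta> \<in> Abar k" "mu (pbar k) \<theta> \<noteq> mu (pbar k) \<theta>0"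
proof -
  have "pbar k \<in> informative_prices P mu (Abar k)"
    using sel[OF det_set_subset] true_param_in_det_set by blast
  then obtain \<theta> \<theta>' where "\<theta> \<in> Abar k" "\<theta>' \<in> Abar k" "mu (pbar k) \<theta> \<noteq> mu (pbar k) \<theta>'"
    using card_det_set_ne_1[OF assms] by (auto simp: informative_prices_def)
  then show thesis using that by metis
qed

text \<open>The separating parameter is removed. Indices start at \<open>Suc k\<close> because the
  step from the dummy index 0 to 1 removes nothing.\<close>

lemma det_set_Suc_less: "Abar (Suc k) \<noteq> {\<theta>0} \<Longrightarrow> Abar (Suc (Suc k)) \<subset> Abar (Suc k)"
  by (rule separating_param[of "Suc k"]) (auto simp: indistinguishable_def)

text \<open>Finite sets cannot shrink strictly forever. This makes the \<open>LEAST\<close> in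
  \<open>K\<close> meaningful.\<close>

lemma det_set_identifies: "\<exists>K. Abar (K + 1) = {\<theta>0}"
proof (rule ccontr)
  assume "\<not> ?thesis"
  then have less: "card (Abar (Suc (Suc k))) < card (Abar (Suc k))" for k
    using det_set_Suc_less[of k]
    by (intro psubset_card_mono finite_subset[OF det_set_subset finite_params]) auto
  have "card (Abar (Suc k)) + k \<le> card (Abar 1)" for k
  proof (induction k)
    case (Suc k)
    then show ?case using less[of k] by linarith
  qed simp
  from this[of "Suc (card (Abar 1))"] show False by simp
qed

lemma det_set_final: "Abar (Suc K) = {\<theta>0}"
  using LeastI_ex[OF det_set_identifies] by simp

lemma det_set_before_final: "i < K \<Longrightarrow> Abar (Suc i) \<noteq> {\<theta>0}"
  using not_less_Least[of i "\<lambda>K. Abar (K + 1) = {\<theta>0}"] by simp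

text \<open>Every phase plays a new price, so the data set of that price is empty when the phase starts.\<close>

lemma det_price_fresh:
  assumes "i < j" "j < K"
  shows "pbar (Suc j) \<noteq> pbar (Suc i)"
proof
  assume eq: "pbar (Suc j) = pbar (Suc i)"
  \<comment> \<open>The later price separates a remaining \<open>\<theta>\<close> from
    \<open>\<theta>0\<close>, but \<open>\<theta>\<close> survived the earlier phase, whose price
    therefore does not.\<close>
  obtain \<theta> where \<theta>: "\<theta> \<in> Abar (Suc j)" "mu (pbar (Suc j)) \<theta> \<noteq> mu (pbar (Suc j)) \<theta>0"
    using separating_param[OF det_set_before_final[OF assms(2)]] .
  have "\<theta> \<in> Abar (Suc (Suc i))"
    using det_set_antimono[of "Suc (Suc i)" "Suc j"] assms \<theta> by auto
  then have "mu (pbar (Suc i)) \<theta> = mu (pbar (Suc i)) \<theta>0"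
    by (simp add: indistinguishable_def)
  then show False using \<theta> eq by simp
qed

lemma gap_det_price_pos: "i < K \<Longrightarrow> gap \<Theta> mu (pbar (Suc i)) > 0"
  using separating_param[OF det_set_before_final, of i]
  by (metis gap_pos finite_params true_param det_set_subset subsetD)

text \<open>Triangle inequality: a mean different from the true one is at least a full gap away from
  it, so its loss exceeds half the gap once the loss of \<open>\<theta>0\<close> is below
  half.\<close>

lemma loss_test_eq_det_set_Suc:
  assumes "loss mu (pbar (Suc i)) \<theta>0 D < gap \<Theta> mu (pbar (Suc i)) / 2"
  shows "{\<theta> \<in> Abar (Suc i). loss mu (pbar (Suc i)) \<theta> D < gap \<Theta> mu (pbar (Suc i)) / 2} = Abar (Suc (Suc i))"
proof -
  have "loss mu (pbar (Suc i)) \<theta> D < gap \<Theta> mu (pbar (Suc i)) / 2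
      \<longleftrightarrow> mu (pbar (Suc i)) \<theta> = mu (pbar (Suc i)) \<theta>0" if "\<theta> \<in> \<Theta>" for \<theta>
  proof (cases "mu (pbar (Suc i)) \<theta> = mu (pbar (Suc i)) \<theta>0")
    case False
    then have "gap \<Theta> mu (pbar (Suc i)) \<le> \<bar>mu (pbar (Suc i)) \<theta> - mu (pbar (Suc i)) \<theta>0\<bar>"
      by (intro gap_le finite_params true_param that)
    with assms False show ?thesis unfolding loss_def by linarith
  qed (use assms in \<open>simp add: loss_def\<close>)
  then show ?thesis
    using det_set_subset[of "Suc i"] by (auto simp: indistinguishable_def)
qed

end

section \<open>Runs with good phases\<close>

declare det_set.simps(2) [simp del] phase_end.simps(2) [simp del] arl_state.simps(2) [simp del]

text \<open>Runs are analysed pathwise: \<open>\<omega>\<close> is a plain argument, and no measure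
  is fixed yet.\<close>

locale learning_run = price_selection P \<Theta> mu \<theta>0 sel
  for P :: "real set" and \<Theta> :: "'a set" and mu and \<theta>0 and sel +
  fixes n :: "real \<Rightarrow> real" and T :: nat and N :: "nat \<Rightarrow> nat"
    and Y :: "nat \<Rightarrow> nat \<Rightarrow> real \<Rightarrow> 'w \<Rightarrow> real"
begin

abbreviation "tbar \<equiv> phase_end T N n pbar"
abbreviation "state \<equiv> arl_state \<Theta> mu (gap \<Theta> mu) n sel N Y"

text \<open>Phases are numbered from 0 here: phase \<open>i\<close> covers the periods after
  \<open>tbar i\<close> up to \<open>tbar (Suc i)\<close> and has set \<open>Abar (Suc i)\<close>
  and price \<open>pbar (Suc i)\<close>.\<close>

abbreviation "phase_data i t \<equiv> sampled N Y (pbar (Suc i)) {Suc (tbar i)..t}"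

text \<open>Defined with the deterministic price and periods even on runs that have left the
  deterministic path.\<close>

definition good_phase :: "'w \<Rightarrow> nat \<Rightarrow> bool" where
  "good_phase \<omega> i \<longleftrightarrow>
     loss mu (pbar (Suc i)) \<theta>0 (phase_data i (tbar (Suc i)) \<omega>) < gap \<Theta> mu (pbar (Suc i)) / 2"

lemma state_Suc:
  fixes t \<omega>
  defines "A \<equiv> fst (state \<omega> t)" and "D \<equiv> snd (state \<omega> t)"
  defines "D' \<equiv> D(sel A := D (sel A) + {# Y (Suc t) i (sel A) \<omega>. i \<in># mset_set {..<N (Suc t)} #})"
  shows "fst (state \<omega> (Suc t)) =
      (if card A = 1 \<or> real (size (D' (sel A))) < n (sel A) then A
       else {\<theta> \<in> A. loss mu (sel A) \<theta> (D' (sel A)) < gap \<Theta> mu (sel A) / 2})"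
    and "snd (state \<omega> (Suc t)) = D'"
  by (simp_all add: A_def D_def D'_def split_beta Let_def arl_state.simps(2))

text \<open>The invariant at phase boundaries. The data sets of all later phase prices are included
  so that it passes on to the next phase.\<close>

definition phase_start :: "'w \<Rightarrow> nat \<Rightarrow> bool" where
  "phase_start \<omega> i \<longleftrightarrow> fst (state \<omega> (tbar i)) = Abar (Suc i) \<and>
     (\<forall>j. i \<le> j \<and> j < K \<longrightarrow> snd (state \<omega> (tbar i)) (pbar (Suc j)) = {#})"

text \<open>Below the threshold no test is made, so set and price stay fixed; the later prices
  differ from the current one by \<open>det_price_fresh\<close>. The bound on \<open>t\<close> is
  strict because the test takes place in period \<open>tbar (Suc i)\<close>.\<close>

lemma state_in_phase:
  assumes start: "phase_start \<omega> i" and i: "i < K" and t: "tbar i \<le> t" "t < tbar (Suc i)"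
  shows "fst (state \<omega> t) = Abar (Suc i) \<and>
    snd (state \<omega> t) (pbar (Suc i)) = phase_data i t \<omega> \<and>
    (\<forall>j. i < j \<and> j < K \<longrightarrow> snd (state \<omega> t) (pbar (Suc j)) = {#})"
  using t
proof (induction t rule: dec_induct)
  case base
  then show ?case using start i by (simp add: phase_start_def)
next
  case (step t)
  then have IH: "fst (state \<omega> t) = Abar (Suc i)" "snd (state \<omega> t) (pbar (Suc i)) = phase_data i t \<omega>"
    "\<And>j. i < j \<Longrightarrow> j < K \<Longrightarrow> snd (state \<omega> t) (pbar (Suc j)) = {#}"
    by simp_all
  have data: "snd (state \<omega> (Suc t)) (pbar (Suc i)) = phase_data i (Suc t) \<omega>"
    using IH step.hyps
    by (simp add: state_Suc sampled_Suc)
  have "real (size (phase_data i (Suc t) \<omega>)) < n (pbar (Suc i))"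
    using phase_end_not_reached[of T N n pbar i "Suc t"] step
    by (simp add: size_sampled)
  then have "fst (state \<omega> (Suc t)) = Abar (Suc i)"
    using data IH(1)
    by (simp add: state_Suc)
  with data show ?case
    using IH(1,3) det_price_fresh[of i]
    by (simp add: state_Suc)
qed

lemma phase_start_Suc:
  assumes start: "phase_start \<omega> i" and i: "i < K" and T: "tbar (Suc i) \<le> T"
    and good: "good_phase \<omega> i"
  shows "phase_start \<omega> (Suc i)"
proof -
  have tb: "tbar i < tbar (Suc i)"
    "n (pbar (Suc i)) \<le> real (\<Sum>s = Suc (tbar i)..tbar (Suc i). N s)"
    using phase_end_reached[OF T] by auto
  \<comment> \<open>The last state before the test, which happens in the step to
    \<open>Suc t\<close>.\<close>
  define t where "t = tbar (Suc i) - 1"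
  have t: "tbar (Suc i) = Suc t" "tbar i \<le> t" using tb by (auto simp: t_def)
  have st: "fst (state \<omega> t) = Abar (Suc i)" "snd (state \<omega> t) (pbar (Suc i)) = phase_data i t \<omega>"
    "\<And>j. i < j \<Longrightarrow> j < K \<Longrightarrow> snd (state \<omega> t) (pbar (Suc j)) = {#}"
    using state_in_phase[OF start i t(2)] t by auto
  have data: "snd (state \<omega> (Suc t)) (pbar (Suc i)) = phase_data i (Suc t) \<omega>"
    using st t by (simp add: state_Suc sampled_Suc)
  have "\<not> real (size (phase_data i (Suc t) \<omega>)) < n (pbar (Suc i))"
    using tb t by (simp add: size_sampled)
  \<comment> \<open>Since \<open>i < K\<close>, the set is no singleton, so the test is really
    carried out.\<close>
  then have "fst (state \<omega> (Suc t)) =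
      {\<theta> \<in> Abar (Suc i). loss mu (pbar (Suc i)) \<theta> (phase_data i (Suc t) \<omega>) < gap \<Theta> mu (pbar (Suc i)) / 2}"
    using data st card_det_set_ne_1[OF det_set_before_final[OF i]]
    by (simp add: state_Suc)
  also have "\<dots> = Abar (Suc (Suc i))"
    using good by (intro loss_test_eq_det_set_Suc) (simp add: good_phase_def t)
  finally show ?thesis
    using st det_price_fresh[of i] by (auto simp: phase_start_def t state_Suc)
qed

lemma phase_start:
  assumes "i \<le> K" "tbar i \<le> T" "\<And>j. j < i \<Longrightarrow> good_phase \<omega> j"
  shows "phase_start \<omega> i"
  using assms
proof (induction i)
  case 0
  then show ?case by (simp add: phase_start_def det_set.simps(2))
next
  case (Suc i)
  have "tbar i \<le> T" using phase_end_mono[of i "Suc i"] Suc.prems(2) by (rule le_trans) simp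
  then show ?case using Suc by (intro phase_start_Suc Suc.IH) auto
qed

text \<open>Goodness of the phases before \<open>i\<close> suffices, as the test of phase
  \<open>i\<close> affects later periods. Period \<open>t\<close> uses the state after
  \<open>t - 1\<close>, so \<open>t = tbar (Suc i)\<close> is included.\<close>

lemma arl_set_in_phase:
  assumes "i < K" "t \<in> {tbar i + 1..tbar (Suc i)}" "\<And>j. j < i \<Longrightarrow> good_phase \<omega> j"
  shows "arl_set \<Theta> mu (gap \<Theta> mu) n sel N Y t \<omega> = Abar (Suc i)"
proof -
  have "tbar i \<le> T" using assms(2) phase_end_le[of T N n pbar "Suc i"] by auto
  then have "phase_start \<omega> i" using assms by (intro phase_start) auto
  then show ?thesis
    using state_in_phase[of \<omega> i "t - 1"] assms(1,2) unfolding arl_set_def by auto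
qed

text \<open>After phase \<open>K - 1\<close> the set is a singleton, which the algorithm
  keeps.\<close>

lemma arl_set_identified:
  assumes "t \<in> {tbar K + 1..T}" "\<And>j. j < K \<Longrightarrow> good_phase \<omega> j"
  shows "arl_set \<Theta> mu (gap \<Theta> mu) n sel N Y t \<omega> = {\<theta>0}"
proof -
  have start: "phase_start \<omega> K" using assms by (intro phase_start) auto
  have "fst (state \<omega> s) = {\<theta>0}" if "tbar K \<le> s" for s
    using that
  proof (induction s rule: dec_induct)
    case base
    show ?case using start det_set_final by (simp only: phase_start_def)
  next
    case (step s)
    then show ?case by (simp add: state_Suc)
  qed
  moreover have "tbar K \<le> t - 1" using assms(1) by auto
  ultimately show ?thesis by (simp only: arl_set_def)
qed

section \<open>Measurability of the ambiguity sets\<close>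

lemma fst_state_Suc_subset: "fst (state \<omega> (Suc t)) \<subseteq> fst (state \<omega> t)"
  by (auto simp: state_Suc)

lemma fst_state_antimono: "s \<le> t \<Longrightarrow> fst (state \<omega> t) \<subseteq> fst (state \<omega> s)"
  by (rule lift_Suc_antimono_le[where f = "\<lambda>t. fst (state \<omega> t)"], rule fst_state_Suc_subset)

lemma fst_state_subset: "fst (state \<omega> t) \<subseteq> \<Theta>"
  using fst_state_antimono[of 0 t \<omega>] by simp

text \<open>A fixed history \<open>h\<close> of sets determines the played prices. The shift
  \<open>s - 1\<close> appears because the set in force in period \<open>s\<close> is the one after
  period \<open>s - 1\<close>.\<close>

lemma snd_state_eq_sampled:
  assumes "\<And>s. s < t \<Longrightarrow> fst (state \<omega> s) = h s"
  shows "snd (state \<omega> t) p = sampled N Y p {s \<in> {1..t}. sel (h (s - 1)) = p} \<omega>"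
  using assms
proof (induction t)
  case (Suc t)
  let ?S = "{s \<in> {1..t}. sel (h (s - 1)) = p}"
  have IH: "snd (state \<omega> t) p = sampled N Y p ?S \<omega>" and t: "fst (state \<omega> t) = h t"
    using Suc.IH Suc.prems by simp_all
  show ?case
  proof (cases "sel (h t) = p")
    case True
    then have "{s \<in> {1..Suc t}. sel (h (s - 1)) = p} = insert (Suc t) ?S"
      by (auto simp: le_Suc_eq)
    moreover have "sampled N Y p (insert (Suc t) ?S) \<omega>
        = sampled N Y p ?S \<omega> + {# Y (Suc t) i p \<omega>. i \<in># mset_set {..<N (Suc t)} #}"
      by (rule sampled_insert) auto
    ultimately show ?thesis using IH t True by (simp only: state_Suc fun_upd_apply refl if_True)
  next
    case False
    then have "{s \<in> {1..Suc t}. sel (h (s - 1)) = p} = ?S"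
      by (auto simp: le_Suc_eq)
    then show ?thesis using IH t False by (simp only: state_Suc fun_upd_apply) simp
  qed
qed simp

context
  fixes M :: "'w measure"
  assumes Y_measurable: "\<And>t i p. t \<in> {1..T} \<Longrightarrow> i < N t \<Longrightarrow> p \<in> P \<Longrightarrow> Y t i p \<in> borel_measurable M"
begin

lemma loss_sampled_measurable:
  assumes "p \<in> P" "S \<subseteq> {1..T}"
  shows "(\<lambda>\<omega>. loss mu p \<theta> (sampled N Y p S \<omega>)) \<in> borel_measurable M"
proof -
  have S: "finite S" using assms(2) finite_subset by blast
  have [measurable]: "Y s i p \<in> borel_measurable M" if "s \<in> S" "i \<in> {..<N s}" for s i
    using that assms by (intro Y_measurable) auto
  show ?thesis
    unfolding loss_def sum_mset_sampled[OF S] size_sampled[OF S] by measurable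
qed

text \<open>
  Along a fixed history of ambiguity sets the prices are constant, so the data sets are explicit
  and every test is an event.
\<close>

lemma history_event:
  assumes "t \<le> T" "\<And>s. s \<le> t \<Longrightarrow> h s \<subseteq> \<Theta> \<and> h s \<noteq> {}"
  shows "{\<omega> \<in> space M. \<forall>s\<le>t. fst (state \<omega> s) = h s} \<in> sets M"
  using assms
proof (induction t)
  case 0
  then show ?case by simp
next
  case (Suc t)
  define p where "p = sel (h t)"
  define S where "S = {s \<in> {1..Suc t}. sel (h (s - 1)) = p}"
  define nxt where "nxt \<omega> = (if card (h t) = 1 \<or> real (\<Sum>s\<in>S. N s) < n p then h t
       else {\<theta> \<in> h t. loss mu p \<theta> (sampled N Y p S \<omega>) < gap \<Theta> mu p / 2})" for \<omega>
  have p: "p \<in> P" using Suc.prems(2)[of t] sel_in_prices by (simp add: p_def)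
  have S: "finite S" "S \<subseteq> {1..T}" using Suc.prems(1) by (auto simp: S_def)
  have ht: "finite (h t)"
    using Suc.prems(2)[of t] finite_subset[OF _ finite_params] by simp
  note [measurable] = loss_sampled_measurable[OF p S(2)]
  have IH [measurable]: "{\<omega> \<in> space M. \<forall>s\<le>t. fst (state \<omega> s) = h s} \<in> sets M"
    by (rule Suc.IH) (use Suc.prems in auto)
  have step: "fst (state \<omega> (Suc t)) = nxt \<omega>" if "\<forall>s\<le>t. fst (state \<omega> s) = h s" for \<omega>
  proof -
    have data: "snd (state \<omega> (Suc t)) p = sampled N Y p S \<omega>"
    proof -
      let ?h = "\<lambda>s. fst (state \<omega> s)"
      have "S = {s \<in> {1..Suc t}. sel (?h (s - 1)) = p}"
        using that by (auto simp: S_def)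
      then show ?thesis using snd_state_eq_sampled[of "Suc t" \<omega> ?h p] by simp
    qed
    moreover have "fst (state \<omega> t) = h t" using that by simp
    ultimately show ?thesis
      unfolding nxt_def size_sampled[OF S(1), of N Y p \<omega>, symmetric] data[symmetric]
      by (simp add: state_Suc flip: p_def)
  qed
  have "{\<omega> \<in> space M. nxt \<omega> = h (Suc t)} \<in> sets M"
  proof (cases "card (h t) = 1 \<or> real (\<Sum>s\<in>S. N s) < n p")
    case True
    then show ?thesis by (simp only: nxt_def) simp
  next
    case False
    \<comment> \<open>Equality of sets becomes finitely many membership conditions, each decided by
      one measurable loss.\<close>
    then have "{\<omega> \<in> space M. nxt \<omega> = h (Suc t)} =
      {\<omega> \<in> space M. h (Suc t) \<subseteq> h t \<and> (\<forall>\<theta>\<in>h t.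
         loss mu p \<theta> (sampled N Y p S \<omega>) < gap \<Theta> mu p / 2 \<longleftrightarrow> \<theta> \<in> h (Suc t))}"
      unfolding nxt_def by auto
    also have "\<dots> \<in> sets M" using ht by measurable
    finally show ?thesis .
  qed
  moreover have "{\<omega> \<in> space M. \<forall>s\<le>Suc t. fst (state \<omega> s) = h s} =
      {\<omega> \<in> space M. \<forall>s\<le>t. fst (state \<omega> s) = h s} \<inter> {\<omega> \<in> space M. nxt \<omega> = h (Suc t)}"
    using step by (auto simp: le_Suc_eq)
  ultimately show ?case using IH by (simp only: sets.Int)
qed

text \<open>A finite union over all histories that end in \<open>A\<close>. Sets only shrink, so a
  nonempty \<open>A\<close> forces nonempty earlier sets, for which \<open>sel\<close> is known to
  yield a price in \<open>P\<close>.\<close>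

lemma arl_set_event:
  assumes "t \<le> T + 1" "A \<noteq> {}"
  shows "{\<omega> \<in> space M. arl_set \<Theta> mu (gap \<Theta> mu) n sel N Y t \<omega> = A} \<in> sets M"
proof -
  define u where "u = t - 1"
  define H where "H = {h \<in> Pi\<^sub>E {..u} (\<lambda>_. Pow \<Theta> - {{}}). h u = A}"
  have u: "u \<le> T" using assms by (simp add: u_def)
  have "{\<omega> \<in> space M. fst (state \<omega> u) = A} =
      (\<Union>h\<in>H. {\<omega> \<in> space M. \<forall>s\<le>u. fst (state \<omega> s) = h s})"
  proof safe
    fix \<omega> assume \<omega>: "\<omega> \<in> space M" "A = fst (state \<omega> u)"
    let ?h = "\<lambda>s\<in>{..u}. fst (state \<omega> s)"
    have "fst (state \<omega> s) \<noteq> {}" if "s \<le> u" for s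
      using fst_state_antimono[OF that, of \<omega>] \<omega>(2) assms(2) by auto
    then have "?h \<in> H"
      using fst_state_subset \<omega>(2) by (auto simp: H_def)
    then show "\<omega> \<in> (\<Union>h\<in>H. {\<omega> \<in> space M. \<forall>s\<le>u. fst (state \<omega> s) = h s})"
      using \<omega> by (intro UN_I[of ?h]) auto
  qed (auto simp: H_def)
  also have "\<dots> \<in> sets M"
  proof (rule sets.finite_UN)
    show "finite H"
      unfolding H_def using finite_params
      by (intro finite_subset[OF _ finite_PiE[of "{..u}" "\<lambda>_. Pow \<Theta> - {{}}"]]) auto
    fix h assume "h \<in> H"
    then have "h s \<subseteq> \<Theta> \<and> h s \<noteq> {}" if "s \<le> u" for s
      using that by (fastforce simp: H_def PiE_iff)
    then show "{\<omega> \<in> space M. \<forall>s\<le>u. fst (state \<omega> s) = h s} \<in> sets M"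
      by (intro history_event u)
  qed
  finally show ?thesis by (simp add: arl_set_def u_def)
qed

lemma good_phase_event:
  assumes "tbar (Suc i) \<le> T"
  shows "{\<omega> \<in> space M. \<not> good_phase \<omega> i} \<in> sets M"
proof -
  have "pbar (Suc i) \<in> P"
    using sel_in_prices det_set_subset true_param_in_det_set by blast
  note [measurable] = loss_sampled_measurable[OF this, of "{Suc (tbar i)..tbar (Suc i)}"]
  have "{Suc (tbar i)..tbar (Suc i)} \<subseteq> {1..T}" using assms by auto
  then show ?thesis unfolding good_phase_def by measurable
qed

end

end

section \<open>Identification with high probability\<close>

theorem proposition1:
  fixes M :: "'w measure" and Q :: "'q measure"
    and P :: "real set" and \<Theta> :: "'a set" and \<theta>0 :: 'a
    and Dem :: "real \<Rightarrow> 'a \<Rightarrow> 'q \<Rightarrow> real" and \<zeta> :: "real \<Rightarrow> 'q \<Rightarrow> real"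
    and \<eta> :: "real \<Rightarrow> 'a set \<Rightarrow> real" and sel :: "'a set \<Rightarrow> real"
    and T :: nat and N :: "nat \<Rightarrow> nat"
    and Y :: "nat \<Rightarrow> nat \<Rightarrow> real \<Rightarrow> 'w \<Rightarrow> real"
    and v b \<delta> :: real
    and mu :: "real \<Rightarrow> 'a \<Rightarrow> real" and D :: "real \<Rightarrow> real measure"
    and c n :: "real \<Rightarrow> real"
    and Ahat :: "nat \<Rightarrow> 'w \<Rightarrow> 'a set" and Abar :: "nat \<Rightarrow> 'a set"
    and K \<tau> :: nat and tbar :: "nat \<Rightarrow> nat"
  defines "mu \<equiv> mean_demand Q Dem"
    and "D \<equiv> true_demand Q Dem \<zeta> \<theta>0"
    and "c \<equiv> gap \<Theta> mu"
    and "n \<equiv> sample_threshold v b c \<delta>"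
    and "Ahat \<equiv> arl_set \<Theta> mu c n sel N Y"
    and "Abar \<equiv> det_set \<Theta> mu \<theta>0 sel"
    and "K \<equiv> (LEAST K. Abar (K + 1) = {\<theta>0})"
    and "tbar \<equiv> phase_end T N n (\<lambda>k. sel (Abar k))"
    and "\<tau> \<equiv> tbar K"
  assumes "prob_space M" and "prob_space Q"
    and "finite P" and "P \<noteq> {}" and "finite \<Theta>" and "\<theta>0 \<in> \<Theta>"
    and "\<And>p \<theta>. p \<in> P \<Longrightarrow> \<theta> \<in> \<Theta> \<Longrightarrow> integrable Q (Dem p \<theta>)"
    and "\<And>p. p \<in> P \<Longrightarrow> integrable Q (\<zeta> p) \<and> (\<integral>q. \<zeta> p q \<partial>Q) = 0"
    and "demand_model M P D T N Y"
    and "v \<ge> 0" and "b \<ge> 0"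
    (* b * |x| < 1 is the interval (-1/b, 1/b), read as the whole line for b = 0 *)
    and "\<And>p x. p \<in> P \<Longrightarrow> b * \<bar>x\<bar> < 1 \<Longrightarrow>
           integrable (D p) (\<lambda>d. exp (x * (d - mu p \<theta>0))) \<and>
           (\<integral>d. exp (x * (d - mu p \<theta>0)) \<partial>D p) \<le> exp (x\<^sup>2 * v\<^sup>2 / 2)"
    and "\<And>\<theta> \<theta>'. \<theta> \<in> \<Theta> \<Longrightarrow> \<theta>' \<in> \<Theta> \<Longrightarrow> \<theta> \<noteq> \<theta>' \<Longrightarrow> \<exists>p\<in>P. \<bar>mu p \<theta> - mu p \<theta>'\<bar> > 0"
    and "\<And>p A. p \<in> P \<Longrightarrow> A \<subseteq> \<Theta> \<Longrightarrow> A \<noteq> {} \<Longrightarrow> \<eta> p A \<ge> 0"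
    and "\<And>p A A'. p \<in> P \<Longrightarrow> A \<noteq> {} \<Longrightarrow> A \<subseteq> A' \<Longrightarrow> A' \<subseteq> \<Theta> \<Longrightarrow> \<eta> p A \<ge> \<eta> p A'"
    and "\<And>p. p \<in> P \<Longrightarrow> \<eta> p {\<theta>0} = expected_revenue mu p \<theta>0"
    and "argmax_rule P \<Theta> mu \<eta> sel"
    and "0 < \<delta>" and "\<delta> \<le> 1"
    (* no sample mean of an empty data set: n = 0 if v = b = 0 *)
    and "v > 0 \<or> b > 0 \<or> (\<forall>t\<in>{1..T}. N t > 0)"
  shows "(\<forall>k\<in>{1..K}. \<forall>t\<in>{tbar (k - 1) + 1..tbar k}.
            measure M {\<omega> \<in> space M. Ahat t \<omega> = Abar k} \<ge> 1 - (real k - 1) * \<delta>) \<and>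
         (\<forall>t\<in>{\<tau> + 1..T}.
            measure M {\<omega> \<in> space M. Ahat t \<omega> = {\<theta>0}} \<ge> 1 - real K * \<delta>)"
proof -
  interpret prob_space M by fact
  interpret learning_run P \<Theta> mu \<theta>0 sel n T N Y
    using assms(14,15,26) by unfold_locales (auto simp: argmax_rule_def is_arg_max_def)
  have demand: "Y t i p \<in> borel_measurable M" "distr M borel (Y t i p) = D p"
    if "t \<in> {1..T}" "i < N t" "p \<in> P" for t i p
    using \<open>demand_model M P D T N Y\<close> that by (auto simp: demand_model_def)
  have indep: "indep_vars (\<lambda>_. PiM P (\<lambda>_. borel)) (\<lambda>(t, i) \<omega>. \<lambda>p\<in>P. Y t i p \<omega>)
      (SIGMA t:{1..T}. {..<N t})"
    using \<open>demand_model M P D T N Y\<close> by (simp add: demand_model_def)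
  \<comment> \<open>\<open>i < K\<close> makes the gap positive, and an end within the horizon
    guarantees enough observations.\<close>
  have bad: "prob {\<omega> \<in> space M. \<not> good_phase \<omega> i} \<le> \<delta>" if i: "i < K" "tbar (Suc i) \<le> T" for i
  proof -
    define p where "p = sel (Abar (Suc i))"
    define S where "S = {Suc (tbar i)..tbar (Suc i)}"
    define I where "I = (SIGMA t:S. {..<N t})"
    define X where "X = (\<lambda>(t, i). Y t i p)"
    have p: "p \<in> P"
      unfolding p_def Abar_def using sel_in_prices det_set_subset true_param_in_det_set by blast
    have S: "S \<subseteq> {1..T}" using i(2) by (auto simp: S_def)
    have I: "finite I" "I \<subseteq> (SIGMA t:{1..T}. {..<N t})" using S by (auto simp: I_def S_def)
    have card_I: "card I = (\<Sum>t\<in>S. N t)" by (simp add: I_def S_def)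
    have cp: "c p > 0"
      using gap_det_price_pos i(1) by (simp add: c_def p_def K_def Abar_def)
    have reached: "tbar i < tbar (Suc i)" "n p \<le> real (card I)"
      using phase_end_reached[of T N n "\<lambda>k. sel (Abar k)" i] i(2)
      by (auto simp: tbar_def p_def card_I S_def)
    \<comment> \<open>If \<open>v\<close> or \<open>b\<close> is positive, so is the threshold.
      Otherwise it is 0, and the last assumption supplies a customer in each period of the
      phase.\<close>
    have "I \<noteq> {}"
    proof (cases "v > 0 \<or> b > 0")
      case True
      then have "max (2 * (v / c p)\<^sup>2) (b / c p) > 0" using cp by (auto simp: less_max_iff_disj)
      then have "n p > 0"
        using \<open>0 < \<delta>\<close> \<open>\<delta> \<le> 1\<close> by (simp add: n_def sample_threshold_def)
      then show ?thesis using reached(2) by auto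
    next
      case False
      then have "N (tbar (Suc i)) > 0" using assms(29) i(2) reached(1) by auto
      then have "(tbar (Suc i), 0) \<in> I" using reached(1) by (auto simp: I_def S_def)
      then show ?thesis by blast
    qed
    \<comment> \<open>Independence holds for the customers' demand vectors over all prices;
      projecting to coordinate \<open>p\<close> preserves it.\<close>
    have X_indep: "indep_vars (\<lambda>_. borel) X I"
    proof -
      have "indep_vars (\<lambda>_. borel) (\<lambda>j \<omega>. ((\<lambda>(t, i) \<omega>. \<lambda>p\<in>P. Y t i p \<omega>) j \<omega>) p) I"
        using p by (intro indep_vars_compose2[OF indep_vars_subset[OF indep I(2)]]) simp
      also have "(\<lambda>j \<omega>. ((\<lambda>(t, i) \<omega>. \<lambda>p\<in>P. Y t i p \<omega>) j \<omega>) p) = X"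
        using p by (auto simp: X_def fun_eq_iff)
      finally show ?thesis .
    qed
    have mgf: "integrable M (\<lambda>\<omega>. exp (l * (X j \<omega> - mu p \<theta>0)))"
      "expectation (\<lambda>\<omega>. exp (l * (X j \<omega> - mu p \<theta>0))) \<le> exp (l\<^sup>2 * v\<^sup>2 / 2)"
      if "j \<in> I" "b * \<bar>l\<bar> < 1" for j l
    proof -
      have X: "X j \<in> borel_measurable M" "D p = distr M borel (X j)"
        using that(1) I(2) demand p by (auto simp: X_def)
      show "integrable M (\<lambda>\<omega>. exp (l * (X j \<omega> - mu p \<theta>0)))"
        "expectation (\<lambda>\<omega>. exp (l * (X j \<omega> - mu p \<theta>0))) \<le> exp (l\<^sup>2 * v\<^sup>2 / 2)"
        using assms(21)[OF p that(2)] unfolding X(2)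
        by (simp_all add: integrable_distr_eq[OF X(1)] integral_distr[OF X(1)])
    qed
    have X_sum: "(\<Sum>j\<in>I. X j \<omega>) = (\<Sum>t\<in>S. \<Sum>i<N t. Y t i p \<omega>)" for \<omega>
      by (simp add: I_def X_def S_def sum.Sigma split_beta)
    have "prob {\<omega> \<in> space M. c p / 2 \<le> \<bar>mu p \<theta>0 - (\<Sum>j\<in>I. X j \<omega>) / real (card I)\<bar>} \<le> \<delta>"
      using reached(2) mgf cp I(1) \<open>I \<noteq> {}\<close> X_indep assms(19,20,27,28)
      by (intro sample_mean_deviation[where v = v and b = b]) (auto simp: n_def sample_threshold_def)
    also have "{\<omega> \<in> space M. c p / 2 \<le> \<bar>mu p \<theta>0 - (\<Sum>j\<in>I. X j \<omega>) / real (card I)\<bar>}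
        = {\<omega> \<in> space M. \<not> good_phase \<omega> i}"
      by (simp add: X_sum card_I good_phase_def loss_def sum_mset_sampled size_sampled not_less
          S_def p_def c_def Abar_def tbar_def)
    finally show ?thesis .
  qed
  \<comment> \<open>Common form of both claims. The completed phases must end by \<open>T\<close>;
    the phase in progress may run past the horizon.\<close>
  have phases: "prob {\<omega> \<in> space M. Ahat t \<omega> = A} \<ge> 1 - real i * \<delta>"
    if "i \<le> K" "tbar i \<le> T" "t \<le> T + 1" "A \<noteq> {}"
      and follows: "\<And>\<omega>. (\<And>j. j < i \<Longrightarrow> good_phase \<omega> j) \<Longrightarrow> Ahat t \<omega> = A" for i t A
  proof (rule union_bound_good_events[where G = good_phase])
    fix j assume "j < i"
    then have "tbar (Suc j) \<le> T"
      using phase_end_mono[of "Suc j" i T N n "\<lambda>k. sel (Abar k)"] that(2) by (simp add: tbar_def)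
    then show "{\<omega> \<in> space M. \<not> good_phase \<omega> j} \<in> sets M" "prob {\<omega> \<in> space M. \<not> good_phase \<omega> j} \<le> \<delta>"
      using bad[of j] good_phase_event[OF demand(1), of j] \<open>j < i\<close> that(1)
      by (auto simp: tbar_def Abar_def)
  next
    show "{\<omega> \<in> space M. Ahat t \<omega> = A} \<in> sets M"
      using arl_set_event[OF demand(1) that(3,4)] by (simp add: Ahat_def c_def)
  qed (use follows in auto)
  show ?thesis
  proof (intro conjI ballI)
    fix k t assume k: "k \<in> {1..K}" and t: "t \<in> {tbar (k - 1) + 1..tbar k}"
    then obtain i where i: "k = Suc i" "i < K" by (cases k) auto
    \<comment> \<open>Together with \<open>tbar i < t\<close> and \<open>t \<le> tbar k\<close> this
      yields \<open>tbar i \<le> T\<close>.\<close>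
    have le: "tbar k \<le> T + 1" using phase_end_le by (simp add: tbar_def)
    have "prob {\<omega> \<in> space M. Ahat t \<omega> = Abar k} \<ge> 1 - real i * \<delta>"
    proof (rule phases)
      show "Abar k \<noteq> {}" using true_param_in_det_set by (auto simp: Abar_def)
      show "Ahat t \<omega> = Abar k" if "\<And>j. j < i \<Longrightarrow> good_phase \<omega> j" for \<omega>
        using arl_set_in_phase[of i t \<omega>] i t that
        by (simp add: Ahat_def Abar_def tbar_def c_def K_def)
    qed (use i t le in auto)
    then show "1 - (real k - 1) * \<delta> \<le> prob {\<omega> \<in> space M. Ahat t \<omega> = Abar k}" by (simp add: i)
  next
    fix t assume t: "t \<in> {\<tau> + 1..T}"
    show "1 - real K * \<delta> \<le> prob {\<omega> \<in> space M. Ahat t \<omega> = {\<theta>0}}"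
    proof (rule phases)
      show "Ahat t \<omega> = {\<theta>0}" if "\<And>j. j < K \<Longrightarrow> good_phase \<omega> j" for \<omega>
        using arl_set_identified[of t \<omega>] t that
        by (simp add: Ahat_def Abar_def tbar_def c_def K_def \<tau>_def)
    qed (use t in \<open>auto simp: \<tau>_def\<close>)
  qed
qed

end
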